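(* Let $\langle\mathrm{Proc},\Sigma,\to\rangle$ be a labelled transition system over a finite alphabet $\Sigma$. Then the following equalities of topologies on $\mathrm{Proc}$ hold: $\tau_O=\tau_{\mathcal L_T}$; $\tau_{\mathrm{sim}}=\tau_{\mathcal L_S}$; and $\tau^{\mathrm{fin}}_{\mathrm{bis}}=\tau_{\mathrm{HML}}$.
   Context: A labelled transition system is $\langle \mathrm{Proc},\Sigma,\to\rangle$ with $\to\subseteq \mathrm{Proc}\times\Sigma\times\mathrm{Proc}$. For a family $\mathcal F$ of subsets of $\mathrm{Proc}$, $\langle\mathcal F\rangle$ is the smallest topology on $\mathrm{Proc}$ containing $\mathcal F$. Trace topology: a finite word $a_1\cdots a_n\in\Sigma^*$ belongs to $\mathrm{Trc}(p)$ iff there are processes with $p=p_0\xrightarrow{a_1}p_1\cdots\xrightarrow{a_n}p_n$ (the empty word always belongs). For $s\in\Sigma^*$, $O(s)=\{p\in\mathrm{Proc}\mid s\in\mathrm{Trc}(p)\}$ and $\tau_O=\langle\{O(s)\mid s\in\Sigma^*\}\rangle$. Finite loop-free processes: $\mathrm{Proc}_F$ is the set of terms generated by $q::=0\mid a.q\mid q+q$ with $a\in\Sigma$. Transitions: $q\xrightarrow{a}_F q'$ iff $q=a.q'$, or $q=q_1+q_2$ and ($q_1\xrightarrow{a}_F q'$ or $q_2\xrightarrow{a}_F q'$); $0$ has no transitions. Simulation topology: $R\subseteq\mathrm{Proc}_F\times\mathrm{Proc}$ is a simulation if whenever $(q,p)\in R$ and $q\xrightarrow{a}_F q'$, there is $p'\in\mathrm{Proc}$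 with $p\xrightarrow{a}p'$ and $(q',p')\in R$. Write $q\sqsubseteq_S p$ if $(q,p)\in R$ for some simulation $R$. $O(q)=\{p\in\mathrm{Proc}\mid q\sqsubseteq_S p\}$, and $\tau_{\mathrm{sim}}$ is generated by the basis $\{O(q)\mid q\in\mathrm{Proc}_F\}$. Finite-depth bisimulation topology: $\sim_k$ is defined inductively between processes of (possibly different) labelled transition systems over $\Sigma$: $x\sim_0 y$ always; $x\sim_{k+1}y$ iff (i) whenever $x\xrightarrow{a}x'$ there is $y'$ with $y\xrightarrow{a}y'$ and $x'\sim_k y'$, and (ii) whenever $y\xrightarrow{a}y'$ there is $x'$ with $x\xrightarrow{a}x'$ and $x'\sim_k y'$. $O^k_{\mathrm{bis}}(q)=\{p\in\mathrm{Proc}\mid q\sim_k p\}$, and $\tau^{\mathrm{fin}}_{\mathrm{bis}}$ is generated by the basis $\{O^k_{\mathrm{bis}}(q)\mid q\in\mathrm{Proc}_F,\ k\in\mathbb N\}$. Logics (with $a\in\Sigma$): $\mathcal L_T$ consists of the formulas $\varphi::=\mathsf{tt}\mid\mathsf{ff}\mid\varphi\wedge\varphi\mid\varphi\vee\varphi\mid\langle a\rangle\psi$, where $\psi::=\mathsf{tt}\mid\mathsf{ff}\mid\langle a\rangle\psi$. $\mathcal L_S$ consists of $\varphi::=\mathsf{tt}\mid\mathsf{ff}\mid\varphi\wedge\varphi\mid\varphi\vee\varphi\mid\langle a\rangle\varphi$. $\mathrm{HML}$ consists of $\varphi::=\mathsf{tt}\mid\mathsf{ff}\mid\varphi\wedge\varphi\mid\varphi\vee\varphi\mid\langle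 a\rangle\varphi\mid[a]\varphi$. Semantics: constants, $\wedge$, $\vee$ as usual; $p\models\langle a\rangle\varphi$ iff there is $p\xrightarrow{a}q$ with $q\models\varphi$; $p\models[a]\varphi$ iff $q\models\varphi$ for all $p\xrightarrow{a}q$. $[\![\varphi]\!]=\{p\in\mathrm{Proc}\mid p\models\varphi\}$, and for each of these logics $\mathcal L$, $\tau_{\mathcal L}=\langle\{[\![\varphi]\!]\mid\varphi\in\mathcal L\}\rangle$. *)

theory Defs
  imports "HOL-Analysis.Abstract_Topology"
begin

text \<open>
  A labelled transition system is given by a set \<open>Proc\<close> of processes, an alphabet \<open>\<Sigma>\<close> and a
  set \<open>T \<subseteq> Proc \<times> \<Sigma> \<times> Proc\<close> of transitions; each definition takes only the components
  it depends on.
\<close>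

type_synonym ('p, 'a) transitions = "('p \<times> 'a \<times> 'p) set"

text \<open>
  The smallest topology on \<open>X\<close> containing a family \<open>\<F> \<subseteq> Pow X\<close>. The carrier of
  \<^const>\<open>topology_generated_by\<close> is the union of its argument, hence the added \<open>X\<close>.
\<close>

definition gen_topology :: "'p set \<Rightarrow> 'p set set \<Rightarrow> 'p topology" where
  "gen_topology X \<F> = topology_generated_by (insert X \<F>)"

lemma topspace_gen_topology:
  assumes "\<F> \<subseteq> Pow X"
  shows "topspace (gen_topology X \<F>) = X"
  using assms unfolding gen_topology_def by auto

lemma openin_gen_topology_iff:
  assumes "\<F> \<subseteq> Pow X"
  shows "openin (gen_topology X \<F>) U \<longleftrightarrow>
    (\<forall>\<tau>. topspace \<tau> = X \<and> (\<forall>F\<in>\<F>. openin \<tau> F) \<longrightarrow> openin \<tau> U)"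
proof
  assume "openin (gen_topology X \<F>) U"
  then have gen: "generate_topology_on (insert X \<F>) U"
    by (simp add: gen_topology_def openin_topology_generated_by_iff)
  show "\<forall>\<tau>. topspace \<tau> = X \<and> (\<forall>F\<in>\<F>. openin \<tau> F) \<longrightarrow> openin \<tau> U"
  proof (intro allI impI)
    fix \<tau> :: "'a topology"
    assume \<tau>: "topspace \<tau> = X \<and> (\<forall>F\<in>\<F>. openin \<tau> F)"
    from gen show "openin \<tau> U"
      by induction (use \<tau> in auto)
  qed
next
  assume "\<forall>\<tau>. topspace \<tau> = X \<and> (\<forall>F\<in>\<F>. openin \<tau> F) \<longrightarrow> openin \<tau> U"
  moreover have "\<forall>F\<in>\<F>. openin (gen_topology X \<F>) F"
    by (simp add: gen_topology_def topology_generated_by_Basis)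
  ultimately show "openin (gen_topology X \<F>) U"
    using topspace_gen_topology[OF assms] by blast
qed


subsection \<open>Trace topology\<close>

definition Trc :: "('p, 'a) transitions \<Rightarrow> 'p \<Rightarrow> 'a list set" where
  "Trc T p = {s. \<exists>r :: nat \<Rightarrow> 'p. r 0 = p \<and> (\<forall>i < length s. (r i, s ! i, r (Suc i)) \<in> T)}"

definition O_trc :: "'p set \<Rightarrow> ('p, 'a) transitions \<Rightarrow> 'a list \<Rightarrow> 'p set" where
  "O_trc Proc T s = {p \<in> Proc. s \<in> Trc T p}"

definition tau_O :: "'p set \<Rightarrow> 'a set \<Rightarrow> ('p, 'a) transitions \<Rightarrow> 'p topology" where
  "tau_O Proc \<Sigma> T = gen_topology Proc {O_trc Proc T s | s. s \<in> lists \<Sigma>}"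


subsection \<open>Finite loop-free processes\<close>

datatype 'a fproc = Nil_F | Pre_F 'a "'a fproc" | Plus_F "'a fproc" "'a fproc"

inductive_set Proc_F :: "'a set \<Rightarrow> 'a fproc set" for \<Sigma> :: "'a set" where
  "Nil_F \<in> Proc_F \<Sigma>"
| "a \<in> \<Sigma> \<Longrightarrow> q \<in> Proc_F \<Sigma> \<Longrightarrow> Pre_F a q \<in> Proc_F \<Sigma>"
| "q1 \<in> Proc_F \<Sigma> \<Longrightarrow> q2 \<in> Proc_F \<Sigma> \<Longrightarrow> Plus_F q1 q2 \<in> Proc_F \<Sigma>"

text \<open>
  Transitions are defined on terms over the whole type \<open>'a\<close>; those starting in
  \<open>Proc_F \<Sigma>\<close> have their label in \<open>\<Sigma>\<close> and end in \<open>Proc_F \<Sigma>\<close>.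
\<close>

inductive_set T_F :: "('a fproc, 'a) transitions" where
  "(Pre_F a q, a, q) \<in> T_F"
| "(q1, a, q') \<in> T_F \<Longrightarrow> (Plus_F q1 q2, a, q') \<in> T_F"
| "(q2, a, q') \<in> T_F \<Longrightarrow> (Plus_F q1 q2, a, q') \<in> T_F"

lemma T_F_closed:
  assumes "(q, a, q') \<in> T_F" and "q \<in> Proc_F \<Sigma>"
  shows "a \<in> \<Sigma>" and "q' \<in> Proc_F \<Sigma>"
  using assms by (induction rule: T_F.induct) (auto elim: Proc_F.cases)


subsection \<open>Simulation topology\<close>

definition simulation ::
  "'p set \<Rightarrow> 'a set \<Rightarrow> ('p, 'a) transitions \<Rightarrow> ('a fproc \<times> 'p) set \<Rightarrow> bool" where
  "simulation Proc \<Sigma> T R \<longleftrightarrow> R \<subseteq> Proc_F \<Sigma> \<times> Proc \<and>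
    (\<forall>q p a q'. (q, p) \<in> R \<and> (q, a, q') \<in> T_F \<longrightarrow>
      (\<exists>p'. (p, a, p') \<in> T \<and> (q', p') \<in> R))"

definition similar ::
  "'p set \<Rightarrow> 'a set \<Rightarrow> ('p, 'a) transitions \<Rightarrow> 'a fproc \<Rightarrow> 'p \<Rightarrow> bool" where
  "similar Proc \<Sigma> T q p \<longleftrightarrow> (\<exists>R. simulation Proc \<Sigma> T R \<and> (q, p) \<in> R)"

definition O_sim :: "'p set \<Rightarrow> 'a set \<Rightarrow> ('p, 'a) transitions \<Rightarrow> 'a fproc \<Rightarrow> 'p set" where
  "O_sim Proc \<Sigma> T q = {p \<in> Proc. similar Proc \<Sigma> T q p}"

text \<open>
  The topology generated by a basis is the smallest topology containing it, so
  \<^const>\<open>gen_topology\<close> is also used for the families that are in fact bases.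
\<close>

definition tau_sim :: "'p set \<Rightarrow> 'a set \<Rightarrow> ('p, 'a) transitions \<Rightarrow> 'p topology" where
  "tau_sim Proc \<Sigma> T = gen_topology Proc {O_sim Proc \<Sigma> T q | q. q \<in> Proc_F \<Sigma>}"


subsection \<open>Finite-depth bisimulation topology\<close>

primrec bisim_upto ::
  "('x, 'a) transitions \<Rightarrow> ('y, 'a) transitions \<Rightarrow> nat \<Rightarrow> 'x \<Rightarrow> 'y \<Rightarrow> bool" where
  "bisim_upto S T 0 x y \<longleftrightarrow> True"
| "bisim_upto S T (Suc k) x y \<longleftrightarrow>
    (\<forall>a x'. (x, a, x') \<in> S \<longrightarrow> (\<exists>y'. (y, a, y') \<in> T \<and> bisim_upto S T k x' y')) \<and>
    (\<forall>a y'. (y, a, y') \<in> T \<longrightarrow> (\<exists>x'. (x, a, x') \<in> S \<and> bisim_upto S T k x' y'))"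

definition O_bis :: "'p set \<Rightarrow> ('p, 'a) transitions \<Rightarrow> nat \<Rightarrow> 'a fproc \<Rightarrow> 'p set" where
  "O_bis Proc T k q = {p \<in> Proc. bisim_upto T_F T k q p}"

definition tau_bis_fin :: "'p set \<Rightarrow> 'a set \<Rightarrow> ('p, 'a) transitions \<Rightarrow> 'p topology" where
  "tau_bis_fin Proc \<Sigma> T = gen_topology Proc {O_bis Proc T k q | k q. q \<in> Proc_F \<Sigma>}"


subsection \<open>Logics\<close>

datatype 'a form =
    TT
  | FF
  | Conj "'a form" "'a form"
  | Disj "'a form" "'a form"
  | Dia 'a "'a form"
  | Box 'a "'a form"

primrec sat :: "('p, 'a) transitions \<Rightarrow> 'p \<Rightarrow> 'a form \<Rightarrow> bool" where
  "sat T p TT \<longleftrightarrow> True"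
| "sat T p FF \<longleftrightarrow> False"
| "sat T p (Conj \<phi> \<psi>) \<longleftrightarrow> sat T p \<phi> \<and> sat T p \<psi>"
| "sat T p (Disj \<phi> \<psi>) \<longleftrightarrow> sat T p \<phi> \<or> sat T p \<psi>"
| "sat T p (Dia a \<phi>) \<longleftrightarrow> (\<exists>q. (p, a, q) \<in> T \<and> sat T q \<phi>)"
| "sat T p (Box a \<phi>) \<longleftrightarrow> (\<forall>q. (p, a, q) \<in> T \<longrightarrow> sat T q \<phi>)"

definition sem :: "'p set \<Rightarrow> ('p, 'a) transitions \<Rightarrow> 'a form \<Rightarrow> 'p set" where
  "sem Proc T \<phi> = {p \<in> Proc. sat T p \<phi>}"

definition tau_logic ::
  "'p set \<Rightarrow> ('p, 'a) transitions \<Rightarrow> 'a form set \<Rightarrow> 'p topology" where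
  "tau_logic Proc T L = gen_topology Proc {sem Proc T \<phi> | \<phi>. \<phi> \<in> L}"

text \<open>The auxiliary syntactic category \<open>\<psi>\<close> in the grammar of \<open>\<L>\<^sub>T\<close>.\<close>

inductive_set LT_path :: "'a set \<Rightarrow> 'a form set" for \<Sigma> :: "'a set" where
  "TT \<in> LT_path \<Sigma>"
| "FF \<in> LT_path \<Sigma>"
| "a \<in> \<Sigma> \<Longrightarrow> \<psi> \<in> LT_path \<Sigma> \<Longrightarrow> Dia a \<psi> \<in> LT_path \<Sigma>"

inductive_set L_T :: "'a set \<Rightarrow> 'a form set" for \<Sigma> :: "'a set" where
  "TT \<in> L_T \<Sigma>"
| "FF \<in> L_T \<Sigma>"
| "\<phi>1 \<in> L_T \<Sigma> \<Longrightarrow> \<phi>2 \<in> L_T \<Sigma> \<Longrightarrow> Conj \<phi>1 \<phi>2 \<in> L_T \<Sigma>"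
| "\<phi>1 \<in> L_T \<Sigma> \<Longrightarrow> \<phi>2 \<in> L_T \<Sigma> \<Longrightarrow> Disj \<phi>1 \<phi>2 \<in> L_T \<Sigma>"
| "a \<in> \<Sigma> \<Longrightarrow> \<psi> \<in> LT_path \<Sigma> \<Longrightarrow> Dia a \<psi> \<in> L_T \<Sigma>"

inductive_set L_S :: "'a set \<Rightarrow> 'a form set" for \<Sigma> :: "'a set" where
  "TT \<in> L_S \<Sigma>"
| "FF \<in> L_S \<Sigma>"
| "\<phi>1 \<in> L_S \<Sigma> \<Longrightarrow> \<phi>2 \<in> L_S \<Sigma> \<Longrightarrow> Conj \<phi>1 \<phi>2 \<in> L_S \<Sigma>"
| "\<phi>1 \<in> L_S \<Sigma> \<Longrightarrow> \<phi>2 \<in> L_S \<Sigma> \<Longrightarrow> Disj \<phi>1 \<phi>2 \<in> L_S \<Sigma>"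
| "a \<in> \<Sigma> \<Longrightarrow> \<phi> \<in> L_S \<Sigma> \<Longrightarrow> Dia a \<phi> \<in> L_S \<Sigma>"

inductive_set HML :: "'a set \<Rightarrow> 'a form set" for \<Sigma> :: "'a set" where
  "TT \<in> HML \<Sigma>"
| "FF \<in> HML \<Sigma>"
| "\<phi>1 \<in> HML \<Sigma> \<Longrightarrow> \<phi>2 \<in> HML \<Sigma> \<Longrightarrow> Conj \<phi>1 \<phi>2 \<in> HML \<Sigma>"
| "\<phi>1 \<in> HML \<Sigma> \<Longrightarrow> \<phi>2 \<in> HML \<Sigma> \<Longrightarrow> Disj \<phi>1 \<phi>2 \<in> HML \<Sigma>"
| "a \<in> \<Sigma> \<Longrightarrow> \<phi> \<in> HML \<Sigma> \<Longrightarrow> Dia a \<phi> \<in> HML \<Sigma>"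
| "a \<in> \<Sigma> \<Longrightarrow> \<phi> \<in> HML \<Sigma> \<Longrightarrow> Box a \<phi> \<in> HML \<Sigma>"

end

theory Submission
  imports Defs
begin

text \<open>
  Each basic open set is defined by a formula of the corresponding logic: a trace by a chain of
  diamonds, a simulation by the conjunction of diamonds read off the finite process, and
  \<open>k\<close>-step bisimilarity to a finite process by its characteristic formula, where \<open>[a]\<close> is needed
  for finitely many labels only. Conversely, every formula denotes a union of basic open sets:
  a simulation formula has a disjunctive normal form whose disjuncts are finite processes,
  and an HML formula is invariant under \<open>\<sim>\<^sub>k\<close> for some \<open>k\<close>, while over a finite alphabet every
  process is \<open>\<sim>\<^sub>k\<close>-equivalent to one of finitely many finite processes.
\<close>

section \<open>Comparison of generated topologies\<close>

text \<open>Open sets arise from generators by finite intersections and arbitrary unions, so testing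
  generators suffices. The carrier \<open>X\<close> counts as a generator too, and it is open on
  both sides by construction.\<close>

lemma gen_topology_openin_mono:
  assumes "\<And>F. F \<in> \<F> \<Longrightarrow> openin (gen_topology X \<G>) F"
    and "openin (gen_topology X \<F>) U"
  shows "openin (gen_topology X \<G>) U"
proof -
  have "generate_topology_on (insert X \<F>) U"
    using assms(2) by (simp add: gen_topology_def openin_topology_generated_by_iff)
  then show ?thesis
  proof induction
    case (Basis s)
    have "openin (gen_topology X \<G>) X"
      by (simp add: gen_topology_def topology_generated_by_Basis)
    with Basis assms(1) show ?case by blast
  qed auto
qed

lemma gen_topology_eqI:
  assumes "\<And>F. F \<in> \<F> \<Longrightarrow> openin (gen_topology X \<G>) F"
    and "\<And>G. G \<in> \<G> \<Longrightarrow> openin (gen_topology X \<F>) G"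
  shows "gen_topology X \<F> = gen_topology X \<G>"
  unfolding topology_eq
  using gen_topology_openin_mono[of \<F> X \<G>, OF assms(1)]
    gen_topology_openin_mono[of \<G> X \<F>, OF assms(2)] by blast

lemma openin_gen_topology_base: "F \<in> \<F> \<Longrightarrow> openin (gen_topology X \<F>) F"
  by (simp add: gen_topology_def topology_generated_by_Basis)

lemma openin_gen_topology_UN:
  "(\<And>i. i \<in> I \<Longrightarrow> B i \<in> \<F>) \<Longrightarrow> openin (gen_topology X \<F>) (\<Union>i\<in>I. B i)"
  by (auto intro: openin_gen_topology_base)

lemma openin_gen_topology_carrier: "openin (gen_topology X \<F>) X"
  by (simp add: gen_topology_def topology_generated_by_Basis)

section \<open>Traces\<close>

lemma Nil_in_Trc [simp]: "[] \<in> Trc T p"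
  by (auto simp: Trc_def)

text \<open>Replaces runs given as functions on indices by a recursion on the word, matching the
  semantics of a diamond.\<close>

lemma Cons_in_Trc_iff: "a # s \<in> Trc T p \<longleftrightarrow> (\<exists>q. (p, a, q) \<in> T \<and> s \<in> Trc T q)"
proof
  assume "a # s \<in> Trc T p"
  then obtain r where r: "r 0 = p" "\<And>i. i < Suc (length s) \<Longrightarrow> (r i, (a # s) ! i, r (Suc i)) \<in> T"
    by (auto simp: Trc_def)
  have "(p, a, r 1) \<in> T"
    using r(2)[of 0] r(1) by simp
  moreover have "s \<in> Trc T (r 1)"
    using r(2)[of "Suc _"] unfolding Trc_def by (intro CollectI exI[of _ "\<lambda>i. r (Suc i)"]) simp
  ultimately show "\<exists>q. (p, a, q) \<in> T \<and> s \<in> Trc T q" by blast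
next
  assume "\<exists>q. (p, a, q) \<in> T \<and> s \<in> Trc T q"
  then obtain q r where "(p, a, q) \<in> T" and "r 0 = q"
    and "\<forall>i < length s. (r i, s ! i, r (Suc i)) \<in> T"
    by (auto simp: Trc_def)
  then show "a # s \<in> Trc T p"
    unfolding Trc_def
    \<comment> \<open>\<open>case_nat p r\<close> is the run \<open>r\<close> delayed by one index,
      with \<open>p\<close> put in front.\<close>
    by (intro CollectI exI[of _ "case_nat p r"]) (auto simp: nth_Cons split: nat.split)
qed

fun trace_form :: "'a list \<Rightarrow> 'a form" where
  "trace_form [] = TT"
| "trace_form (a # s) = Dia a (trace_form s)"

lemma trace_form_in_LT_path: "s \<in> lists \<Sigma> \<Longrightarrow> trace_form s \<in> LT_path \<Sigma>"
  by (induction s) (auto intro: LT_path.intros)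

lemma LT_path_subset_L_T: "LT_path \<Sigma> \<subseteq> L_T \<Sigma>"
  by (auto elim: LT_path.cases intro: L_T.intros)

lemma sat_trace_form: "sat T p (trace_form s) \<longleftrightarrow> s \<in> Trc T p"
  by (induction s arbitrary: p) (auto simp: Cons_in_Trc_iff)

text \<open>A path formula is a chain of diamonds ending in \<open>TT\<close> or \<open>FF\<close>:
  the first kind expresses a trace, the second is unsatisfiable.\<close>

lemma LT_path_cases_trace:
  assumes "\<psi> \<in> LT_path \<Sigma>"
  shows "(\<forall>p. \<not> sat T p \<psi>) \<or> (\<exists>s\<in>lists \<Sigma>. \<forall>p. sat T p \<psi> \<longleftrightarrow> s \<in> Trc T p)"
  using assms
proof induction
  case 1
  show ?case by (auto intro!: bexI[of _ "[]"])
next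
  case (3 a \<psi>)
  from "3.IH" show ?case
  proof
    assume "\<exists>s\<in>lists \<Sigma>. \<forall>p. sat T p \<psi> \<longleftrightarrow> s \<in> Trc T p"
    then obtain s where "s \<in> lists \<Sigma>" "\<forall>p. sat T p \<psi> \<longleftrightarrow> s \<in> Trc T p" by blast
    with "3.hyps" show ?thesis
      by (intro disjI2 bexI[of _ "a # s"]) (auto simp: Cons_in_Trc_iff)
  qed simp
qed simp

lemma openin_tau_O_LT_path:
  assumes "\<psi> \<in> LT_path \<Sigma>"
  shows "openin (tau_O Proc \<Sigma> T) (sem Proc T \<psi>)"
  using LT_path_cases_trace[OF assms, of T]
proof (elim disjE bexE)
  assume "\<forall>p. \<not> sat T p \<psi>"
  then have "sem Proc T \<psi> = {}" by (auto simp: sem_def)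
  then show ?thesis by simp
next
  fix s assume "s \<in> lists \<Sigma>" "\<forall>p. sat T p \<psi> \<longleftrightarrow> s \<in> Trc T p"
  then have "sem Proc T \<psi> \<in> {O_trc Proc T s | s. s \<in> lists \<Sigma>}"
    by (auto simp: sem_def O_trc_def)
  then show ?thesis unfolding tau_O_def by (rule openin_gen_topology_base)
qed

lemma sem_simps:
  "sem Proc T TT = Proc"
  "sem Proc T FF = {}"
  "sem Proc T (Conj \<phi> \<psi>) = sem Proc T \<phi> \<inter> sem Proc T \<psi>"
  "sem Proc T (Disj \<phi> \<psi>) = sem Proc T \<phi> \<union> sem Proc T \<psi>"
  by (auto simp: sem_def)

text \<open>Conjunction and disjunction turn into intersection and union, under which open sets are
  closed; diamonds only occur in front of path formulas.\<close>

lemma openin_tau_O_L_T: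
  assumes "\<phi> \<in> L_T \<Sigma>"
  shows "openin (tau_O Proc \<Sigma> T) (sem Proc T \<phi>)"
  using assms
proof induction
  case 1
  show ?case by (simp add: sem_simps tau_O_def openin_gen_topology_carrier)
next
  case (5 a \<psi>)
  then show ?case by (intro openin_tau_O_LT_path LT_path.intros)
qed (auto simp: sem_simps)

lemma tau_O_eq_tau_L_T: "tau_O Proc \<Sigma> T = tau_logic Proc T (L_T \<Sigma>)"
  unfolding tau_O_def tau_logic_def
proof (rule gen_topology_eqI)
  fix F assume "F \<in> {O_trc Proc T s | s. s \<in> lists \<Sigma>}"
  then obtain s where s: "F = O_trc Proc T s" "s \<in> lists \<Sigma>" by blast
  then have "F = sem Proc T (trace_form s)"
    by (simp add: O_trc_def sem_def sat_trace_form)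
  moreover have "trace_form s \<in> L_T \<Sigma>"
    using trace_form_in_LT_path[OF s(2)] LT_path_subset_L_T by blast
  ultimately show "openin (gen_topology Proc {sem Proc T \<phi> | \<phi>. \<phi> \<in> L_T \<Sigma>}) F"
    by (intro openin_gen_topology_base) blast
next
  fix G assume "G \<in> {sem Proc T \<phi> | \<phi>. \<phi> \<in> L_T \<Sigma>}"
  then show "openin (gen_topology Proc {O_trc Proc T s | s. s \<in> lists \<Sigma>}) G"
    using openin_tau_O_L_T by (fastforce simp: tau_O_def)
qed

section \<open>Simulations\<close>

lemma T_F_simps [simp]:
  "(Nil_F, a, q') \<notin> T_F"
  "(Pre_F b q, a, q') \<in> T_F \<longleftrightarrow> a = b \<and> q' = q"
  "(Plus_F q1 q2, a, q') \<in> T_F \<longleftrightarrow> (q1, a, q') \<in> T_F \<or> (q2, a, q') \<in> T_F"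
  by (auto elim: T_F.cases intro: T_F.intros)

text \<open>A sum becomes a conjunction because a simulating process must match the moves of both
  summands.\<close>

fun sim_form :: "'a fproc \<Rightarrow> 'a form" where
  "sim_form Nil_F = TT"
| "sim_form (Pre_F a q) = Dia a (sim_form q)"
| "sim_form (Plus_F q1 q2) = Conj (sim_form q1) (sim_form q2)"

lemma sim_form_in_L_S: "q \<in> Proc_F \<Sigma> \<Longrightarrow> sim_form q \<in> L_S \<Sigma>"
  by (induction rule: Proc_F.induct) (auto intro: L_S.intros)

text \<open>Satisfaction of \<open>sim_form\<close> unfolds exactly like the transfer condition of a
  simulation, which makes the satisfaction relation a candidate simulation.\<close>

lemma sat_sim_form_iff:
  "sat T p (sim_form q) \<longleftrightarrow>
    (\<forall>a q'. (q, a, q') \<in> T_F \<longrightarrow> (\<exists>p'. (p, a, p') \<in> T \<and> sat T p' (sim_form q')))"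
  by (induction q) auto

lemma simulation_sat_sim_form:
  assumes "simulation Proc \<Sigma> T R" and "(q, p) \<in> R"
  shows "sat T p (sim_form q)"
proof -
  \<comment> \<open>Structural induction on \<open>q\<close> passes to summands, which need not be
    related to \<open>p\<close> by \<open>R\<close>. The claim is therefore generalised: only the
    moves of \<open>q\<close> have to be matched into \<open>R\<close>, a condition inherited by
    both summands.\<close>
  have "sat T p (sim_form q)"
    if "\<And>a q'. (q, a, q') \<in> T_F \<Longrightarrow> \<exists>p'. (p, a, p') \<in> T \<and> (q', p') \<in> R" for q p
    using that
  proof (induction q arbitrary: p)
    case (Pre_F a q)
    then obtain p' where "(p, a, p') \<in> T" "(q, p') \<in> R" by auto
    moreover from this(2) assms(1) have "sat T p' (sim_form q)"
      by (intro Pre_F.IH) (simp add: simulation_def)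
    ultimately show ?case by auto
  qed simp_all
  then show ?thesis using assms by (simp add: simulation_def)
qed

lemma similar_iff_sat:
  assumes "T \<subseteq> Proc \<times> \<Sigma> \<times> Proc" "q \<in> Proc_F \<Sigma>" "p \<in> Proc"
  shows "similar Proc \<Sigma> T q p \<longleftrightarrow> sat T p (sim_form q)"
proof
  assume "similar Proc \<Sigma> T q p"
  then show "sat T p (sim_form q)"
    by (auto simp: similar_def dest: simulation_sat_sim_form)
next
  \<comment> \<open>The largest candidate: satisfaction itself, restricted to the carriers. Closure
    of \<open>Proc_F \<Sigma>\<close> under \<open>T_F\<close> and the typing of \<open>T\<close>
    keep successors inside it.\<close>
  let ?R = "{(q, p) \<in> Proc_F \<Sigma> \<times> Proc. sat T p (sim_form q)}"
  assume "sat T p (sim_form q)"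
  then have "(q, p) \<in> ?R" using assms by simp
  moreover have "simulation Proc \<Sigma> T ?R"
    unfolding simulation_def
  proof (intro conjI allI impI)
    fix q p a q' assume *: "(q, p) \<in> ?R \<and> (q, a, q') \<in> T_F"
    then obtain p' where "(p, a, p') \<in> T" "sat T p' (sim_form q')"
      using sat_sim_form_iff[of T p q] by auto
    moreover have "q' \<in> Proc_F \<Sigma>" using * T_F_closed(2) by fastforce
    ultimately show "\<exists>p'. (p, a, p') \<in> T \<and> (q', p') \<in> ?R" using assms(1) by auto
  qed auto
  ultimately show "similar Proc \<Sigma> T q p" unfolding similar_def by blast
qed

lemma O_sim_eq_sem:
  assumes "T \<subseteq> Proc \<times> \<Sigma> \<times> Proc" "q \<in> Proc_F \<Sigma>"
  shows "O_sim Proc \<Sigma> T q = sem Proc T (sim_form q)"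
  using similar_iff_sat[OF assms] by (auto simp: O_sim_def sem_def)

text \<open>Disjunctions are pulled outwards: conjunction distributes over them and a diamond
  commutes with them. On the side of processes these operations are pairwise sums and
  prefixing.\<close>

lemma L_S_disjunctive_normal_form:
  assumes "\<phi> \<in> L_S \<Sigma>"
  shows "\<exists>Q \<subseteq> Proc_F \<Sigma>. \<forall>p. sat T p \<phi> \<longleftrightarrow> (\<exists>q\<in>Q. sat T p (sim_form q))"
  using assms
proof induction
  case 1
  show ?case by (intro exI[of _ "{Nil_F}"]) (auto intro: Proc_F.intros)
next
  case 2
  show ?case by (intro exI[of _ "{}"]) auto
next
  case (3 \<phi>1 \<phi>2)
  then obtain Q1 Q2 where "Q1 \<subseteq> Proc_F \<Sigma>" "Q2 \<subseteq> Proc_F \<Sigma>"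
    "\<And>p. sat T p \<phi>1 \<longleftrightarrow> (\<exists>q\<in>Q1. sat T p (sim_form q))"
    "\<And>p. sat T p \<phi>2 \<longleftrightarrow> (\<exists>q\<in>Q2. sat T p (sim_form q))" by metis
  then show ?case
    by (intro exI[of _ "(\<lambda>(q1, q2). Plus_F q1 q2) ` (Q1 \<times> Q2)"]) (auto intro: Proc_F.intros)
next
  case (4 \<phi>1 \<phi>2)
  then obtain Q1 Q2 where "Q1 \<subseteq> Proc_F \<Sigma>" "Q2 \<subseteq> Proc_F \<Sigma>"
    "\<And>p. sat T p \<phi>1 \<longleftrightarrow> (\<exists>q\<in>Q1. sat T p (sim_form q))"
    "\<And>p. sat T p \<phi>2 \<longleftrightarrow> (\<exists>q\<in>Q2. sat T p (sim_form q))" by metis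
  then show ?case by (intro exI[of _ "Q1 \<union> Q2"]) auto
next
  case (5 a \<phi>)
  then obtain Q where "Q \<subseteq> Proc_F \<Sigma>"
    "\<And>p. sat T p \<phi> \<longleftrightarrow> (\<exists>q\<in>Q. sat T p (sim_form q))" by metis
  with "5.hyps" show ?case
    by (intro exI[of _ "Pre_F a ` Q"]) (auto intro: Proc_F.intros)
qed

lemma tau_sim_eq_tau_L_S:
  assumes "T \<subseteq> Proc \<times> \<Sigma> \<times> Proc"
  shows "tau_sim Proc \<Sigma> T = tau_logic Proc T (L_S \<Sigma>)"
  unfolding tau_sim_def tau_logic_def
proof (rule gen_topology_eqI)
  fix F assume "F \<in> {O_sim Proc \<Sigma> T q | q. q \<in> Proc_F \<Sigma>}"
  then have "F \<in> {sem Proc T \<phi> | \<phi>. \<phi> \<in> L_S \<Sigma>}"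
    using O_sim_eq_sem[OF assms] sim_form_in_L_S by blast
  then show "openin (gen_topology Proc {sem Proc T \<phi> | \<phi>. \<phi> \<in> L_S \<Sigma>}) F"
    by (rule openin_gen_topology_base)
next
  fix G assume "G \<in> {sem Proc T \<phi> | \<phi>. \<phi> \<in> L_S \<Sigma>}"
  then obtain \<phi> where \<phi>: "G = sem Proc T \<phi>" "\<phi> \<in> L_S \<Sigma>" by blast
  obtain Q where Q: "Q \<subseteq> Proc_F \<Sigma>" "\<And>p. sat T p \<phi> \<longleftrightarrow> (\<exists>q\<in>Q. sat T p (sim_form q))"
    using L_S_disjunctive_normal_form[OF \<phi>(2)] by metis
  have "G = (\<Union>q\<in>Q. sem Proc T (sim_form q))"
    using \<phi> Q by (auto simp: sem_def)
  also have "\<dots> = (\<Union>q\<in>Q. O_sim Proc \<Sigma> T q)"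
    using Q(1) O_sim_eq_sem[OF assms] by blast
  finally show "openin (gen_topology Proc {O_sim Proc \<Sigma> T q | q. q \<in> Proc_F \<Sigma>}) G"
    using Q(1) by (simp only:) (rule openin_gen_topology_UN, blast)
qed

section \<open>Finite-depth bisimilarity\<close>

lemma bisim_upto_Suc_imp: "bisim_upto S T (Suc k) x y \<Longrightarrow> bisim_upto S T k x y"
proof (induction k arbitrary: x y)
  case (Suc k)
  \<comment> \<open>Only the outermost level is unfolded, so that successors stay related at level
    \<open>Suc k\<close>, the form the induction hypothesis expects.\<close>
  note step = Suc.prems[THEN iffD1[OF bisim_upto.simps(2)]]
  show ?case
    unfolding bisim_upto.simps(2)[of S T k]
  proof (intro conjI allI impI)
    fix a x' assume "(x, a, x') \<in> S"
    with step obtain y' where "(y, a, y') \<in> T" "bisim_upto S T (Suc k) x' y'" by blast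
    with Suc.IH show "\<exists>y'. (y, a, y') \<in> T \<and> bisim_upto S T k x' y'" by blast
  next
    fix a y' assume "(y, a, y') \<in> T"
    with step obtain x' where "(x, a, x') \<in> S" "bisim_upto S T (Suc k) x' y'" by blast
    with Suc.IH show "\<exists>x'. (x, a, x') \<in> S \<and> bisim_upto S T k x' y'" by blast
  qed
qed simp

lemma bisim_upto_antimono:
  assumes "k \<le> l" "bisim_upto S T l x y"
  shows "bisim_upto S T k x y"
  using assms
proof (induction rule: dec_induct)
  case (step n)
  then show ?case using bisim_upto_Suc_imp[of S T n x y] by simp
qed

text \<open>The modal depth of \<open>\<phi>\<close> can serve as \<open>k\<close>: binary
  connectives take the maximum of the two levels, by antimonotonicity, and each modality adds one.
  The two systems may differ, so that \<open>T_F\<close> can be compared with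
  \<open>T\<close>.\<close>

lemma sat_invariant_bisim_upto:
  "\<exists>k. \<forall>x y. bisim_upto S T k x y \<longrightarrow> (sat S x \<phi> \<longleftrightarrow> sat T y \<phi>)"
proof (induction \<phi>)
  case (Conj \<phi> \<psi>)
  then obtain k l where k: "\<And>x y. bisim_upto S T k x y \<Longrightarrow> sat S x \<phi> \<longleftrightarrow> sat T y \<phi>"
    and l: "\<And>x y. bisim_upto S T l x y \<Longrightarrow> sat S x \<psi> \<longleftrightarrow> sat T y \<psi>" by blast
  have "sat S x (Conj \<phi> \<psi>) \<longleftrightarrow> sat T y (Conj \<phi> \<psi>)" if "bisim_upto S T (max k l) x y" for x y
    using k[OF bisim_upto_antimono[OF max.cobounded1 that]]
      l[OF bisim_upto_antimono[OF max.cobounded2 that]] by simp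
  then show ?case by blast
next
  case (Disj \<phi> \<psi>)
  then obtain k l where k: "\<And>x y. bisim_upto S T k x y \<Longrightarrow> sat S x \<phi> \<longleftrightarrow> sat T y \<phi>"
    and l: "\<And>x y. bisim_upto S T l x y \<Longrightarrow> sat S x \<psi> \<longleftrightarrow> sat T y \<psi>" by blast
  have "sat S x (Disj \<phi> \<psi>) \<longleftrightarrow> sat T y (Disj \<phi> \<psi>)" if "bisim_upto S T (max k l) x y" for x y
    using k[OF bisim_upto_antimono[OF max.cobounded1 that]]
      l[OF bisim_upto_antimono[OF max.cobounded2 that]] by simp
  then show ?case by blast
next
  case (Dia a \<phi>)
  then obtain k where k: "\<And>x y. bisim_upto S T k x y \<Longrightarrow> sat S x \<phi> \<longleftrightarrow> sat T y \<phi>" by blast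
  have "sat S x (Dia a \<phi>) \<longleftrightarrow> sat T y (Dia a \<phi>)" if "bisim_upto S T (Suc k) x y" for x y
    using that k unfolding bisim_upto.simps sat.simps by metis
  then show ?case by blast
next
  case (Box a \<phi>)
  then obtain k where k: "\<And>x y. bisim_upto S T k x y \<Longrightarrow> sat S x \<phi> \<longleftrightarrow> sat T y \<phi>" by blast
  have "sat S x (Box a \<phi>) \<longleftrightarrow> sat T y (Box a \<phi>)" if "bisim_upto S T (Suc k) x y" for x y
    using that k unfolding bisim_upto.simps sat.simps by metis
  then show ?case by blast
qed auto

section \<open>Finite approximants up to a given depth\<close>

lemma Proc_F_with_successors:
  assumes "finite S" "S \<subseteq> \<Sigma> \<times> Proc_F \<Sigma>"
  shows "\<exists>q\<in>Proc_F \<Sigma>. \<forall>a q'. (q, a, q') \<in> T_F \<longleftrightarrow> (a, q') \<in> S"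
  using assms
proof (induction S)
  case empty
  show ?case by (intro bexI[of _ Nil_F]) (auto intro: Proc_F.intros)
next
  case (insert x S)
  then obtain q where q: "q \<in> Proc_F \<Sigma>" "\<forall>a q'. (q, a, q') \<in> T_F \<longleftrightarrow> (a, q') \<in> S" by auto
  obtain b r where "x = (b, r)" by (cases x)
  with insert.prems q show ?case
    \<comment> \<open>The summand \<open>Pre_F b r\<close> contributes exactly the transition
      \<open>(b, r)\<close>.\<close>
    by (intro bexI[of _ "Plus_F (Pre_F b r) q"]) (auto intro: Proc_F.intros)
qed

text \<open>Up to level \<open>Suc k\<close> a process is determined by the pairs of a label and a
  level-\<open>k\<close> representative of a successor. Over a finite alphabet with finitely many
  representatives only finitely many sets of such pairs exist.\<close>

lemma finite_approximants:
  assumes T: "T \<subseteq> Proc \<times> \<Sigma> \<times> Proc" and fin: "finite \<Sigma>"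
  shows "\<exists>Q. finite Q \<and> Q \<subseteq> Proc_F \<Sigma> \<and> (\<forall>p. \<exists>q\<in>Q. bisim_upto T_F T k q p)"
proof (induction k)
  case 0
  show ?case by (intro exI[of _ "{Nil_F}"]) (auto intro: Proc_F.intros)
next
  case (Suc k)
  then obtain Q where Q: "finite Q" "Q \<subseteq> Proc_F \<Sigma>" "\<And>p. \<exists>q\<in>Q. bisim_upto T_F T k q p"
    by blast
  \<comment> \<open>Choice fixes one term for each possible successor set, so the new
    representatives form the image of a finite power set.\<close>
  have "\<exists>f. \<forall>S\<in>Pow (\<Sigma> \<times> Q).
      f S \<in> Proc_F \<Sigma> \<and> (\<forall>a q'. (f S, a, q') \<in> T_F \<longleftrightarrow> (a, q') \<in> S)"
  proof (intro bchoice ballI)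
    fix S assume "S \<in> Pow (\<Sigma> \<times> Q)"
    then have "finite S" "S \<subseteq> \<Sigma> \<times> Proc_F \<Sigma>"
      using Q(1,2) fin by (auto intro: finite_subset[of S "\<Sigma> \<times> Q"])
    then show "\<exists>q. q \<in> Proc_F \<Sigma> \<and> (\<forall>a q'. (q, a, q') \<in> T_F \<longleftrightarrow> (a, q') \<in> S)"
      using Proc_F_with_successors by blast
  qed
  then obtain f where "\<forall>S\<in>Pow (\<Sigma> \<times> Q).
      f S \<in> Proc_F \<Sigma> \<and> (\<forall>a q'. (f S, a, q') \<in> T_F \<longleftrightarrow> (a, q') \<in> S)" ..
  then have f: "\<And>S. S \<subseteq> \<Sigma> \<times> Q \<Longrightarrow> f S \<in> Proc_F \<Sigma>"
    "\<And>S a q'. S \<subseteq> \<Sigma> \<times> Q \<Longrightarrow> (f S, a, q') \<in> T_F \<longleftrightarrow> (a, q') \<in> S"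
    by simp_all
  have "\<exists>q \<in> f ` Pow (\<Sigma> \<times> Q). bisim_upto T_F T (Suc k) q p" for p
  proof -
    let ?S = "{(a, q) \<in> \<Sigma> \<times> Q. \<exists>p'. (p, a, p') \<in> T \<and> bisim_upto T_F T k q p'}"
    have sub: "?S \<subseteq> \<Sigma> \<times> Q" by blast
    have "bisim_upto T_F T (Suc k) (f ?S) p"
      unfolding bisim_upto.simps f(2)[OF sub]
    proof (intro conjI allI impI)
      \<comment> \<open>Matching moves of \<open>p\<close> uses a representative of
        \<open>p'\<close> from \<open>Q\<close>; the converse direction is built into
        \<open>?S\<close>.\<close>
      fix a p' assume "(p, a, p') \<in> T"
      moreover from this T have "a \<in> \<Sigma>" by blast
      moreover obtain q where "q \<in> Q" "bisim_upto T_F T k q p'" using Q(3) by blast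
      ultimately show "\<exists>q. (a, q) \<in> ?S \<and> bisim_upto T_F T k q p'" by blast
    qed blast
    with sub show ?thesis by blast
  qed
  then show ?case
    using f(1) fin Q(1) by (intro exI[of _ "f ` Pow (\<Sigma> \<times> Q)"]) auto
qed

section \<open>Characteristic formulas in HML\<close>

lemma finite_T_F_successors: "finite {s. (q, s) \<in> T_F}"
proof (induction q)
  case (Plus_F q1 q2)
  have "{s. (Plus_F q1 q2, s) \<in> T_F} = {s. (q1, s) \<in> T_F} \<union> {s. (q2, s) \<in> T_F}" by auto
  with Plus_F show ?case by simp
next
  case (Pre_F b q)
  have "{s. (Pre_F b q, s) \<in> T_F} = {(b, q)}" by auto
  then show ?case by simp
next
  case Nil_F
  show ?case by (rule finite_subset[of _ "{}"]) auto
qed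

text \<open>Working with properties instead of formulas hides the syntax: conjunctions and
  disjunctions over finite sets need no chosen enumeration.\<close>

definition HML_definable :: "'a set \<Rightarrow> ('p, 'a) transitions \<Rightarrow> ('p \<Rightarrow> bool) \<Rightarrow> bool" where
  "HML_definable \<Sigma> T P \<longleftrightarrow> (\<exists>\<phi>\<in>HML \<Sigma>. \<forall>p. sat T p \<phi> \<longleftrightarrow> P p)"

lemma HML_definable_True: "HML_definable \<Sigma> T (\<lambda>p. True)"
  unfolding HML_definable_def by (intro bexI[of _ TT]) (auto intro: HML.intros)

lemma HML_definable_False: "HML_definable \<Sigma> T (\<lambda>p. False)"
  unfolding HML_definable_def by (intro bexI[of _ FF]) (auto intro: HML.intros)

lemma HML_definable_conj:
  assumes "HML_definable \<Sigma> T P" "HML_definable \<Sigma> T Q"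
  shows "HML_definable \<Sigma> T (\<lambda>p. P p \<and> Q p)"
proof -
  obtain \<phi> \<psi> where "\<phi> \<in> HML \<Sigma>" "\<forall>p. sat T p \<phi> \<longleftrightarrow> P p" "\<psi> \<in> HML \<Sigma>" "\<forall>p. sat T p \<psi> \<longleftrightarrow> Q p"
    using assms unfolding HML_definable_def by blast
  then show ?thesis
    unfolding HML_definable_def by (intro bexI[of _ "Conj \<phi> \<psi>"]) (auto intro: HML.intros)
qed

lemma HML_definable_disj:
  assumes "HML_definable \<Sigma> T P" "HML_definable \<Sigma> T Q"
  shows "HML_definable \<Sigma> T (\<lambda>p. P p \<or> Q p)"
proof -
  obtain \<phi> \<psi> where "\<phi> \<in> HML \<Sigma>" "\<forall>p. sat T p \<phi> \<longleftrightarrow> P p" "\<psi> \<in> HML \<Sigma>" "\<forall>p. sat T p \<psi> \<longleftrightarrow> Q p"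
    using assms unfolding HML_definable_def by blast
  then show ?thesis
    unfolding HML_definable_def by (intro bexI[of _ "Disj \<phi> \<psi>"]) (auto intro: HML.intros)
qed

lemma HML_definable_dia:
  assumes "a \<in> \<Sigma>" "HML_definable \<Sigma> T P"
  shows "HML_definable \<Sigma> T (\<lambda>p. \<exists>p'. (p, a, p') \<in> T \<and> P p')"
proof -
  obtain \<phi> where "\<phi> \<in> HML \<Sigma>" "\<forall>p. sat T p \<phi> \<longleftrightarrow> P p"
    using assms unfolding HML_definable_def by blast
  with assms(1) show ?thesis
    unfolding HML_definable_def by (intro bexI[of _ "Dia a \<phi>"]) (auto intro: HML.intros)
qed

lemma HML_definable_box:
  assumes "a \<in> \<Sigma>" "HML_definable \<Sigma> T P"
  shows "HML_definable \<Sigma> T (\<lambda>p. \<forall>p'. (p, a, p') \<in> T \<longrightarrow> P p')"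
proof -
  obtain \<phi> where "\<phi> \<in> HML \<Sigma>" "\<forall>p. sat T p \<phi> \<longleftrightarrow> P p"
    using assms unfolding HML_definable_def by blast
  with assms(1) show ?thesis
    unfolding HML_definable_def by (intro bexI[of _ "Box a \<phi>"]) (auto intro: HML.intros)
qed

lemma HML_definable_finite_ball:
  assumes "finite I" "\<And>i. i \<in> I \<Longrightarrow> HML_definable \<Sigma> T (P i)"
  shows "HML_definable \<Sigma> T (\<lambda>p. \<forall>i\<in>I. P i p)"
  using assms by (induction I) (simp_all add: HML_definable_True HML_definable_conj)

lemma HML_definable_finite_bex:
  assumes "finite I" "\<And>i. i \<in> I \<Longrightarrow> HML_definable \<Sigma> T (P i)"
  shows "HML_definable \<Sigma> T (\<lambda>p. \<exists>i\<in>I. P i p)"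
  using assms by (induction I) (simp_all add: HML_definable_False HML_definable_disj)

text \<open>The classical characteristic formula: a diamond for every transition of
  \<open>q\<close>, and for every label a box over the disjunction of the matching successors. Both
  conjunctions are finite, as \<open>q\<close> is finitely branching and \<open>\<Sigma>\<close> is
  finite.\<close>

lemma HML_definable_bisim_upto:
  assumes T: "T \<subseteq> Proc \<times> \<Sigma> \<times> Proc" and fin: "finite \<Sigma>" and "q \<in> Proc_F \<Sigma>"
  shows "HML_definable \<Sigma> T (bisim_upto T_F T k q)"
  using assms(3)
proof (induction k arbitrary: q)
  case 0
  have "bisim_upto T_F T 0 q = (\<lambda>p. True)" by auto
  then show ?case by (simp only: HML_definable_True)
next
  case (Suc k)
  let ?S = "{s. (q, s) \<in> T_F}"
  \<comment> \<open>Both clauses are rewritten with bounded quantifiers over finite sets. For a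
    label that \<open>q\<close> cannot perform, the inner disjunction is empty and the box forbids
    that label.\<close>
  have "bisim_upto T_F T (Suc k) q = (\<lambda>p.
      (\<forall>s\<in>?S. \<exists>p'. (p, fst s, p') \<in> T \<and> bisim_upto T_F T k (snd s) p') \<and>
      (\<forall>a\<in>\<Sigma>. \<forall>p'. (p, a, p') \<in> T \<longrightarrow>
        (\<exists>q'\<in>snd ` {s \<in> ?S. fst s = a}. bisim_upto T_F T k q' p')))"
    (is "_ = ?rhs")
  proof
    fix p
    have "?rhs p \<longleftrightarrow>
        (\<forall>a x'. (q, a, x') \<in> T_F \<longrightarrow> (\<exists>y'. (p, a, y') \<in> T \<and> bisim_upto T_F T k x' y')) \<and>
        (\<forall>a\<in>\<Sigma>. \<forall>y'. (p, a, y') \<in> T \<longrightarrow> (\<exists>x'. (q, a, x') \<in> T_F \<and> bisim_upto T_F T k x' y'))"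
      by (simp add: image_iff split_paired_All Bex_def)
    \<comment> \<open>This makes the quantifier over \<open>\<Sigma>\<close> equivalent to the one
      over all labels in the definition.\<close>
    moreover have "a \<in> \<Sigma>" if "(p, a, y') \<in> T" for a y' using T that by blast
    ultimately show "bisim_upto T_F T (Suc k) q p = ?rhs p"
      unfolding bisim_upto.simps by blast
  qed
  moreover have "HML_definable \<Sigma> T \<dots>"
    using Suc.IH T_F_closed[OF _ Suc.prems] finite_T_F_successors[of q] fin
    by (intro HML_definable_conj HML_definable_finite_ball HML_definable_dia HML_definable_box
        HML_definable_finite_bex) auto
  ultimately show ?case by (simp only:)
qed

lemma tau_bis_fin_eq_tau_HML:
  assumes T: "T \<subseteq> Proc \<times> \<Sigma> \<times> Proc" and fin: "finite \<Sigma>"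
  shows "tau_bis_fin Proc \<Sigma> T = tau_logic Proc T (HML \<Sigma>)"
  unfolding tau_bis_fin_def tau_logic_def
proof (rule gen_topology_eqI)
  fix F assume "F \<in> {O_bis Proc T k q | k q. q \<in> Proc_F \<Sigma>}"
  then obtain k q where F: "F = O_bis Proc T k q" "q \<in> Proc_F \<Sigma>" by blast
  obtain \<phi> where \<phi>: "\<phi> \<in> HML \<Sigma>" "\<forall>p. sat T p \<phi> \<longleftrightarrow> bisim_upto T_F T k q p"
    using HML_definable_bisim_upto[OF T fin F(2)] unfolding HML_definable_def by blast
  then have "F = sem Proc T \<phi>" by (simp add: F(1) O_bis_def sem_def)
  then show "openin (gen_topology Proc {sem Proc T \<phi> | \<phi>. \<phi> \<in> HML \<Sigma>}) F"
    using \<phi>(1) by (intro openin_gen_topology_base) blast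
next
  fix G assume "G \<in> {sem Proc T \<phi> | \<phi>. \<phi> \<in> HML \<Sigma>}"
  then obtain \<phi> where G: "G = sem Proc T \<phi>" by blast
  obtain k where k: "\<And>q p. bisim_upto T_F T k q p \<Longrightarrow> sat T_F q \<phi> \<longleftrightarrow> sat T p \<phi>"
    using sat_invariant_bisim_upto[of T_F T \<phi>] by blast
  have "\<exists>q\<in>Proc_F \<Sigma>. bisim_upto T_F T k q p" for p
    using finite_approximants[OF T fin, of k] by blast
  \<comment> \<open>Each process has a finite representative at level \<open>k\<close>, and
    invariance carries \<open>\<phi>\<close> across that equivalence in both directions.\<close>
  then have "G = (\<Union>q \<in> {q \<in> Proc_F \<Sigma>. sat T_F q \<phi>}. O_bis Proc T k q)"
    using k unfolding G sem_def O_bis_def by blast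
  then show "openin (gen_topology Proc {O_bis Proc T k q | k q. q \<in> Proc_F \<Sigma>}) G"
    by (simp only:) (rule openin_gen_topology_UN, blast)
qed

theorem corollary5p26:
  fixes Proc :: "'p set" and \<Sigma> :: "'a set" and T :: "('p \<times> 'a \<times> 'p) set"
  assumes "T \<subseteq> Proc \<times> \<Sigma> \<times> Proc"
    and "finite \<Sigma>"
  shows "tau_O Proc \<Sigma> T = tau_logic Proc T (L_T \<Sigma>)
    \<and> tau_sim Proc \<Sigma> T = tau_logic Proc T (L_S \<Sigma>)
    \<and> tau_bis_fin Proc \<Sigma> T = tau_logic Proc T (HML \<Sigma>)"
  using tau_O_eq_tau_L_T tau_sim_eq_tau_L_S[OF assms(1)] tau_bis_fin_eq_tau_HML[OF assms] by blast

end
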